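(* Let $R$ be a ring, and let $a\in R$. Then the following are equivalent: (1) $a$ has Zhou inverse. (2) $a-a^{n+1}\in N(R)$ for some $n\in\mathbb{N}$.
   Context: All rings are associative with identity $1$ (not necessarily commutative). $\mathbb{N}$ denotes the positive integers. $N(R)$ is the set of all nilpotent elements of $R$. For $a\in R$, $comm(a)=\{x\in R: xa=ax\}$ and $comm^2(a)=\{x\in R: xy=yx\text{ for all }y\in comm(a)\}$. An element $a\in R$ has Zhou inverse if there exists $b\in R$ such that $b=bab$, $b\in comm^2(a)$ and $a^n-ab\in N(R)$ for some $n\in\mathbb{N}$. *)

theory Defs
  imports Main
begin

text \<open>The sort \<open>{ring, monoid_mult}\<close> stands for arbitrary associative, not necessarily
  commutative rings with identity. Unlike \<open>ring_1\<close> it admits the zero ring.\<close>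

definition nilpotents :: "'a :: {ring, monoid_mult} set" where
  "nilpotents = {x. \<exists>k>0. x ^ k = 0}"

definition comm :: "'a :: {ring, monoid_mult} \<Rightarrow> 'a set" where
  "comm a = {x. x * a = a * x}"

definition comm2 :: "'a :: {ring, monoid_mult} \<Rightarrow> 'a set" where
  "comm2 a = {x. \<forall>y\<in>comm a. x * y = y * x}"

definition has_Zhou_inverse :: "'a :: {ring, monoid_mult} \<Rightarrow> bool" where
  "has_Zhou_inverse a \<longleftrightarrow>
     (\<exists>b. b = b * a * b \<and> b \<in> comm2 a \<and> (\<exists>n>0. a ^ n - a * b \<in> nilpotents))"

end

theory Submission
  imports Defs
begin

text \<open>
  Both conditions say that \<open>a\<close> splits along an idempotent \<open>e\<close> commuting with it into
  a nilpotent part and a part on which \<open>a ^ n\<close> is unipotent.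

  Suppose \<open>b\<close> is a Zhou inverse, with \<open>a ^ n - a * b\<close> nilpotent.  Then \<open>e = a * b\<close> is an
  idempotent commuting with \<open>p = a ^ n\<close>, and \<open>p * (1 - p) = (p - e) * (1 - e - p)\<close>.  The right
  side is a nilpotent times an element commuting with it, so \<open>a ^ n * (1 - a ^ n)\<close> is nilpotent,
  and \<open>a * (1 - a ^ n)\<close> is then nilpotent too, since its \<open>n\<close>-th power is a commuting multiple of
  that product.

  Suppose conversely that \<open>a ^ k * (1 - a ^ n) ^ k = 0\<close>.  Expanding the second factor as
  \<open>1 - a * c\<close>, with \<open>c\<close> a polynomial in \<open>a\<close>, gives \<open>a ^ k = a ^ (k + 1) * c\<close>.  This is the
  classical condition for a Drazin inverse, and \<open>b = a ^ k * c ^ (k + 1)\<close> is one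
  (\<open>Drazin_inverse_from_regularity\<close>).  On the summand \<open>e = a * b\<close> the element \<open>a ^ n - e\<close> acts
  as \<open>a ^ n - 1\<close>, on the complement as \<open>a ^ n\<close>; both have vanishing \<open>k\<close>-th power there
  (\<open>power_minus_idempotent_eq_0\<close>).
\<close>

section \<open>Commuting elements and nilpotents\<close>

lemma power_mult_commuting:
  fixes x y :: "'a :: monoid_mult"
  assumes "x * y = y * x"
  shows "(x * y) ^ k = x ^ k * y ^ k"
proof (induction k)
  case (Suc k)
  have "(x * y) ^ Suc k = x * (y * x ^ k) * y ^ k"
    by (simp add: Suc mult.assoc)
  also have "y * x ^ k = x ^ k * y"
    using power_commuting_commutes[OF assms, of k] by simp
  finally show ?case by (simp add: mult.assoc)
qed simp

lemma nilpotents_mult_commuting: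
  fixes x y :: "'a :: {ring, monoid_mult}"
  assumes "x \<in> nilpotents" "x * y = y * x"
  shows "x * y \<in> nilpotents"
  using assms unfolding nilpotents_def by (auto simp: power_mult_commuting)

lemma nilpotents_power_cancel:
  fixes x :: "'a :: {ring, monoid_mult}"
  assumes "x ^ n \<in> nilpotents" "n > 0"
  shows "x \<in> nilpotents"
proof -
  from assms(1) obtain k where "k > 0" "(x ^ n) ^ k = 0"
    by (auto simp: nilpotents_def)
  then have "x ^ (n * k) = 0" "n * k > 0"
    using \<open>n > 0\<close> by (simp_all add: power_mult)
  then show ?thesis
    unfolding nilpotents_def by blast
qed

text \<open>The \<open>n\<close>-th power of \<open>x * y\<close> is \<open>x ^ n * y\<close> times \<open>y ^ (n - 1)\<close>.  Passing to powers in this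
  way avoids sums of commuting nilpotents, and with them the binomial theorem.\<close>

lemma nilpotents_reduce_power_factor:
  fixes x y :: "'a :: {ring, monoid_mult}"
  assumes nil: "x ^ n * y \<in> nilpotents" and "n > 0" and xy: "x * y = y * x"
  shows "x * y \<in> nilpotents"
proof -
  have comm: "x ^ n * y = y * x ^ n"
    using power_commuting_commutes[OF xy] .
  have "(x ^ n * y) * y ^ (n - 1) = y ^ (n - 1) * (x ^ n * y)"
    using power_commuting_commutes[of y "x ^ n" "n - 1"] comm
    by (metis mult.assoc power_commutes)
  with nil have "(x ^ n * y) * y ^ (n - 1) \<in> nilpotents"
    by (rule nilpotents_mult_commuting)
  moreover have "(x ^ n * y) * y ^ (n - 1) = (x * y) ^ n"
    by (simp add: power_mult_commuting[OF xy] mult.assoc power_minus_mult \<open>n > 0\<close>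
        flip: power_Suc)
  ultimately show ?thesis
    using nilpotents_power_cancel \<open>n > 0\<close> by metis
qed

section \<open>The double commutant\<close>

text \<open>The double commutant stands in for the ring of polynomials in \<open>a\<close>: it is a commutative
  subring containing \<open>a\<close>, so identities between its elements can be checked as in a
  commutative ring.\<close>

lemma comm2_self: "a \<in> comm2 a"
  by (auto simp: comm2_def comm_def)

lemma comm2_one: "1 \<in> comm2 a"
  by (simp add: comm2_def)

lemma comm2_add: "x \<in> comm2 a \<Longrightarrow> y \<in> comm2 a \<Longrightarrow> x + y \<in> comm2 a"
  by (simp add: comm2_def algebra_simps)

lemma comm2_diff: "x \<in> comm2 a \<Longrightarrow> y \<in> comm2 a \<Longrightarrow> x - y \<in> comm2 a"
  by (simp add: comm2_def algebra_simps)

lemma comm2_mult: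
  assumes "x \<in> comm2 a" "y \<in> comm2 a"
  shows "x * y \<in> comm2 a"
proof -
  have "(x * y) * z = z * (x * y)" if "z \<in> comm a" for z
  proof -
    have "x * z = z * x" "y * z = z * y"
      using assms that by (auto simp: comm2_def)
    then show ?thesis by (metis mult.assoc)
  qed
  then show ?thesis by (simp add: comm2_def)
qed

lemma comm2_power: "x \<in> comm2 a \<Longrightarrow> x ^ k \<in> comm2 a"
  by (induction k) (simp_all add: comm2_one comm2_mult)

lemmas comm2_intros =
  comm2_self comm2_one comm2_add comm2_diff comm2_mult comm2_power

lemma comm2_commute:
  assumes "x \<in> comm2 a" "y \<in> comm2 a"
  shows "x * y = y * x"
proof -
  have "a \<in> comm a"
    by (simp add: comm_def)
  then have "y * a = a * y"
    using assms(2) unfolding comm2_def by blast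
  then have "y \<in> comm a"
    by (simp add: comm_def)
  then show ?thesis
    using assms(1) unfolding comm2_def by blast
qed

section \<open>From a Zhou inverse to a polynomial condition\<close>

lemma Zhou_inverse_imp_nilpotent_difference:
  fixes a b :: "'a :: {ring, monoid_mult}"
  assumes b: "b = b * a * b" "b \<in> comm2 a" and "n > 0"
    and nil: "a ^ n - a * b \<in> nilpotents"
  shows "a - a ^ (n + 1) \<in> nilpotents"
proof -
  define e p where "e = a * b" and "p = a ^ n"
  have "e * e = a * (b * a * b)"
    by (simp add: e_def mult.assoc)
  then have ee: "e * e = e"
    by (simp only: e_def b(1)[symmetric])
  have mem: "e \<in> comm2 a" "p \<in> comm2 a"
    unfolding e_def p_def by (intro comm2_intros b)+
  have ep: "e * p = p * e"
    using comm2_commute[OF mem] .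
  have "(p - e) * (1 - e - p) \<in> nilpotents"
  proof (rule nilpotents_mult_commuting)
    show "p - e \<in> nilpotents"
      using nil by (simp add: p_def e_def)
    show "(p - e) * (1 - e - p) = (1 - e - p) * (p - e)"
      by (rule comm2_commute[of _ a]) (intro comm2_intros mem)+
  qed
  also have "(p - e) * (1 - e - p) = p * (1 - p)"
    by (simp add: algebra_simps ee ep)
  finally have "a * (1 - a ^ n) \<in> nilpotents"
    unfolding p_def using \<open>n > 0\<close>
    by (rule nilpotents_reduce_power_factor) (rule comm2_commute[of _ a]; intro comm2_intros)
  then show ?thesis
    by (simp add: right_diff_distrib)
qed

section \<open>The Drazin inverse\<close>

text \<open>The hypothesis says that \<open>x\<close> inverts \<open>a\<close> on multiples of \<open>a ^ k\<close>; iterating it,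
  \<open>a ^ j * x ^ j\<close> acts as the identity on them for every \<open>j\<close>.  For \<open>j = k + 1\<close> this product is
  itself a multiple of \<open>a ^ k\<close>, which makes it idempotent.\<close>

lemma Drazin_inverse_from_regularity:
  fixes a x :: "'a :: {ring, monoid_mult}"
  assumes x: "x \<in> comm2 a" and reg: "a ^ k = a ^ (k + 1) * x"
  defines "b \<equiv> a ^ k * x ^ (k + 1)"
  shows "b \<in> comm2 a" and "b * a * b = b" and "a ^ k * (a * b) = a ^ k"
proof -
  show b: "b \<in> comm2 a"
    unfolding b_def by (intro comm2_intros x)
  have iter: "a ^ k * (a ^ j * x ^ j) = a ^ k" for j
  proof (induction j)
    case (Suc j)
    have "a ^ j * x = x * a ^ j"
      by (rule comm2_commute[of _ a]) (intro comm2_intros x)+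
    then have "a * (a ^ j * x) = a * (x * a ^ j)" by simp
    then have "a ^ Suc j * x ^ Suc j = (a * x) * (a ^ j * x ^ j)"
      by (simp add: mult.assoc) (simp flip: mult.assoc)
    then have "a ^ k * (a ^ Suc j * x ^ Suc j) = (a ^ (k + 1) * x) * (a ^ j * x ^ j)"
      by (simp only: Suc_eq_plus1[symmetric] power_Suc2 mult.assoc)
    also have "\<dots> = a ^ k"
      using Suc by (simp only: reg[symmetric])
    finally show ?case .
  qed simp
  show abs: "a ^ k * (a * b) = a ^ k"
    using iter[of "k + 1"] by (simp add: b_def mult.assoc)
  have "a * b \<in> comm2 a"
    by (intro comm2_intros b)
  then have "x ^ (k + 1) * (a * b) = (a * b) * x ^ (k + 1)"
    by (intro comm2_commute[of _ a]) (intro comm2_intros x b)+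
  moreover have "b * a * b = a ^ k * (x ^ (k + 1) * (a * b))"
    unfolding b_def by (simp only: mult.assoc)
  ultimately have "b * a * b = (a ^ k * (a * b)) * x ^ (k + 1)"
    by (simp only: mult.assoc)
  also have "\<dots> = b"
    by (simp only: abs) (simp only: b_def)
  finally show "b * a * b = b" .
qed

text \<open>Constant term 1 is all that matters about the polynomial \<open>(1 - a ^ n) ^ k\<close>: everything
  else can be absorbed into a multiple of \<open>a\<close>.\<close>

lemma power_one_minus_power_expansion:
  fixes a :: "'a :: {ring, monoid_mult}"
  assumes "n > 0"
  shows "\<exists>c\<in>comm2 a. (1 - a ^ n) ^ k = 1 - a * c"
proof (induction k)
  case 0
  have "(0 :: 'a) \<in> comm2 a" by (simp add: comm2_def)
  then show ?case by (intro bexI[of _ 0]) simp_all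
next
  case (Suc k)
  then obtain c where c: "c \<in> comm2 a" "(1 - a ^ n) ^ k = 1 - a * c" by blast
  obtain m where n: "n = Suc m" using \<open>n > 0\<close> by (cases n) auto
  have "(1 - a ^ n) ^ Suc k = (1 - a * c) * (1 - a ^ n)"
    by (simp add: c(2) power_Suc2 del: power_Suc)
  also have "\<dots> = 1 - a * (c + a ^ m - c * a ^ n)"
    by (simp add: n algebra_simps)
  finally show ?case
    by (intro bexI[of _ "c + a ^ m - c * a ^ n"] comm2_intros c(1))
qed

section \<open>From a polynomial condition to a Zhou inverse\<close>

text \<open>The idempotent \<open>e\<close> cuts out the summand on which \<open>a\<close> is invertible.  Multiplying by
  \<open>a ^ k\<close>, hence by \<open>e\<close>, turns \<open>a ^ n - e\<close> into \<open>a ^ n - 1\<close>; multiplying by \<open>1 - e\<close> turns it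
  into \<open>a ^ n\<close>.\<close>

lemma power_minus_idempotent_eq_0:
  fixes a e y :: "'a :: {ring, monoid_mult}"
  assumes e: "e * e = e" "e * a = a * e" "e = y * a ^ k"
    and absorb: "a ^ k * e = a ^ k"
    and zero: "a ^ k * (1 - a ^ n) ^ k = 0" and "n > 0"
  shows "(a ^ n - e) ^ k = 0"
proof -
  define w where "w = a ^ n - e"
  have eq: "a ^ i * e = e * a ^ i" for i
    using power_commuting_commutes[of a e i] e(2) by simp
  have ew: "e * w = w * e"
    by (simp add: w_def algebra_simps eq)
  have akw: "a ^ k * w = a ^ k * (a ^ n - 1)"
    by (simp add: w_def right_diff_distrib absorb)
  have aka: "(a ^ n - 1) * a ^ k = a ^ k * (a ^ n - 1)"
    by (simp add: algebra_simps flip: power_add)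
  have "a ^ k * w ^ j = a ^ k * (a ^ n - 1) ^ j" for j
  proof (induction j)
    case (Suc j)
    have "a ^ k * w ^ Suc j = (a ^ n - 1) * (a ^ k * w ^ j)"
      using akw aka by (simp flip: mult.assoc)
    also have "\<dots> = (a ^ n - 1) * a ^ k * (a ^ n - 1) ^ j"
      by (simp add: Suc mult.assoc)
    finally show ?case
      using aka by (simp add: mult.assoc)
  qed simp
  moreover have "a ^ k * (a ^ n - 1) ^ k = 0"
  proof -
    have "(a ^ n - 1) ^ k = ((1 - a ^ n) * (- 1)) ^ k" by (simp add: algebra_simps)
    also have "\<dots> = (1 - a ^ n) ^ k * (- 1) ^ k"
      by (rule power_mult_commuting) (simp add: algebra_simps)
    finally show ?thesis using zero by (simp flip: mult.assoc)
  qed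
  ultimately have on_e: "e * w ^ k = 0"
    using e(3) by (simp add: mult.assoc)
  have "(1 - e) * w ^ j = (1 - e) * (a ^ n) ^ j" for j
  proof (induction j)
    case (Suc j)
    have "(1 - e) * w ^ Suc j = w * ((1 - e) * w ^ j)"
    proof -
      have "(1 - e) * w = w * (1 - e)"
        using ew by (simp add: left_diff_distrib right_diff_distrib)
      then show ?thesis by (simp flip: mult.assoc)
    qed
    also have "\<dots> = w * (1 - e) * (a ^ n) ^ j"
      by (simp only: Suc mult.assoc)
    also have "w * (1 - e) = (1 - e) * a ^ n"
      by (simp add: w_def algebra_simps eq e(1))
    finally show ?case by (simp add: mult.assoc)
  qed simp
  moreover have "(1 - e) * (a ^ n) ^ k = 0"
  proof -
    obtain m where "n = Suc m" using \<open>n > 0\<close> by (cases n) auto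
    then have "(a ^ n) ^ k = a ^ k * a ^ (m * k)"
      by (simp flip: power_mult power_add power_Suc)
    moreover have "(1 - e) * a ^ k = 0"
      using absorb eq[of k] by (simp add: left_diff_distrib)
    ultimately show ?thesis by (simp flip: mult.assoc)
  qed
  ultimately have "(1 - e) * w ^ k = 0" by simp
  with on_e show ?thesis
    by (simp add: w_def left_diff_distrib)
qed

lemma nilpotent_difference_imp_Zhou_inverse:
  fixes a :: "'a :: {ring, monoid_mult}"
  assumes "a - a ^ (n + 1) \<in> nilpotents" and "n > 0"
  shows "has_Zhou_inverse a"
proof -
  obtain k where "k > 0" and k: "(a - a ^ (n + 1)) ^ k = 0"
    using assms(1) by (auto simp: nilpotents_def)
  have "(a - a ^ (n + 1)) ^ k = (a * (1 - a ^ n)) ^ k"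
    by (simp add: right_diff_distrib)
  also have "\<dots> = a ^ k * (1 - a ^ n) ^ k"
    by (rule power_mult_commuting) (rule comm2_commute[of _ a]; intro comm2_intros)
  finally have zero: "a ^ k * (1 - a ^ n) ^ k = 0"
    using k by simp
  obtain c where c: "c \<in> comm2 a" "(1 - a ^ n) ^ k = 1 - a * c"
    using power_one_minus_power_expansion[OF \<open>n > 0\<close>] by blast
  have reg: "a ^ k = a ^ (k + 1) * c"
    using zero c(2) by (simp add: right_diff_distrib power_Suc2 mult.assoc del: power_Suc)
  define b where "b = a ^ k * c ^ (k + 1)"
  note drazin = Drazin_inverse_from_regularity[OF c(1) reg, folded b_def]
  have "(a ^ n - a * b) ^ k = 0"
  proof (rule power_minus_idempotent_eq_0)
    show "(a * b) * (a * b) = a * b"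
      using drazin(2) by (simp add: mult.assoc)
    show "(a * b) * a = a * (a * b)"
      by (rule comm2_commute[of _ a]) (intro comm2_intros drazin(1))+
    have "c ^ (k + 1) * a ^ k = a ^ k * c ^ (k + 1)"
      by (rule comm2_commute[of _ a]) (intro comm2_intros c(1))+
    then show "a * b = (a * c ^ (k + 1)) * a ^ k"
      by (simp only: b_def mult.assoc)
  qed (use drazin(3) zero \<open>n > 0\<close> in simp_all)
  then have "a ^ n - a * b \<in> nilpotents"
    using \<open>k > 0\<close> by (auto simp: nilpotents_def)
  with drazin(1,2) \<open>n > 0\<close> show ?thesis
    unfolding has_Zhou_inverse_def by (intro exI[of _ b]) auto
qed

theorem theorem4p1:
  fixes a :: "'a :: {ring, monoid_mult}"
  shows "has_Zhou_inverse a \<longleftrightarrow> (\<exists>n>0. a - a ^ (n + 1) \<in> nilpotents)"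
proof
  assume "has_Zhou_inverse a"
  then obtain b n where "b = b * a * b" "b \<in> comm2 a" "n > 0" "a ^ n - a * b \<in> nilpotents"
    unfolding has_Zhou_inverse_def by blast
  then show "\<exists>n>0. a - a ^ (n + 1) \<in> nilpotents"
    using Zhou_inverse_imp_nilpotent_difference by blast
next
  assume "\<exists>n>0. a - a ^ (n + 1) \<in> nilpotents"
  then show "has_Zhou_inverse a"
    using nilpotent_difference_imp_Zhou_inverse by blast
qed

end
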